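(* Let $\{\lambda_{i,\mathcal{D}}\}_{i\ge1}$ be the non-decreasing sequence of eigenvalues (counted according to their multiplicity) of the Dirichlet $W$-$V$-Laplacian $-\Delta_{W,V,\mathcal{D}}$. Then there exists $\rho\in(0,\frac12]$ such that $$Cn^{1/\rho}\le\lambda_{n,\mathcal{D}}\qquad\text{for all } n\ge1$$ for some constant $C>0$. Moreover, $$\sum_{i=1}^{\infty}\frac{1}{\lambda_{i,\mathcal{D}}^{s}}<\infty\qquad\text{for every } s>\rho.$$
   Context: $W,V:\mathbb{R}\to\mathbb{R}$ are strictly increasing, $W$ càdlàg, $V$ càglàd, $W(x+1)-W(x)=W(1)-W(0)$ and $V(x+1)-V(x)=V(1)-V(0)$ for all $x$, both are continuous at $0$ and $W(0)=V(0)=0$. $\mathbb{T}=\mathbb{R}/\mathbb{Z}$ is identified with $[0,1)$. The measures $dW,dV$ are given by $dW((a,b])=W(b)-W(a)$, $dV([a,b))=V(b)-V(a)$, and $L^2_V(\mathbb{T})$ is the $L^2$ space of $dV$. The Dirichlet Laplacian $\Delta_{W,V,\mathcal{D}}$ is the operator in $L^2_V(\mathbb{T})$ whose domain consists of the $f\in L^2_V(\mathbb{T})$ for which there are $b\in\mathbb{R}$ and $\mathfrak{f}\in L^2_V(\mathbb{T})$ with $f(x)=bW(x)+\int_{(0,x]}\int_{[0,y)}\mathfrak{f}(s)\,dV(s)\,dW(y)$ and $bW(1)+\int_{(0,1]}\int_{[0,y)}\mathfrak{f}(s)\,dV(s)\,dW(y)=0$ (so that $f(0)=f(1)=0$); then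 $\Delta_{W,V,\mathcal{D}}f=\mathfrak{f}$. It is self-adjoint, and $-\Delta_{W,V,\mathcal{D}}$ is the inverse of the integral operator on $L^2_V(\mathbb{T})$ with kernel $W(t\wedge s)-W(t)W(s)/W(1)$ with respect to $dV(s)$; its eigenvalues are $0<\lambda_{1,\mathcal{D}}\le\lambda_{2,\mathcal{D}}\le\cdots$. *)

theory Defs
  imports "HOL-Analysis.Analysis" "HOL-Library.Extended_Nat"
begin

definition cadlag :: "(real \<Rightarrow> real) \<Rightarrow> bool" where
  "cadlag f \<longleftrightarrow> (\<forall>x. continuous (at_right x) f \<and> (\<exists>l. (f \<longlongrightarrow> l) (at_left x)))"

definition caglad :: "(real \<Rightarrow> real) \<Rightarrow> bool" where
  "caglad f \<longleftrightarrow> (\<forall>x. continuous (at_left x) f \<and> (\<exists>l. (f \<longlongrightarrow> l) (at_right x)))"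

text \<open>For right-continuous \<open>F\<close>, the library's \<open>interval_measure F\<close> gives \<open>{a<..b}\<close> the mass
  \<open>F b - F a\<close>. For left-continuous \<open>V\<close> we reflect it at the origin, so that \<open>{a..<b}\<close> gets the
  mass \<open>V b - V a\<close>; see \<open>emeasure_left_interval_measure\<close>.\<close>

definition left_interval_measure :: "(real \<Rightarrow> real) \<Rightarrow> real measure" where
  "left_interval_measure V = distr (interval_measure (\<lambda>x. - V (- x))) borel uminus"

lemma emeasure_left_interval_measure:
  assumes "mono V" and "caglad V" and "a \<le> b"
  shows "emeasure (left_interval_measure V) {a..<b} = ennreal (V b - V a)"
proof -
  have cont: "continuous (at_right x) (\<lambda>x. - V (- x))" for x
  proof -
    have "(V \<longlongrightarrow> V (- x)) (at_left (- x))"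
      using assms(2) by (auto simp: caglad_def continuous_within)
    then have "((\<lambda>x. V (- x)) \<longlongrightarrow> V (- x)) (at_right x)"
      by (subst (asm) filterlim_at_left_to_right) simp
    then show ?thesis
      by (auto simp: continuous_within intro: tendsto_minus)
  qed
  have "emeasure (left_interval_measure V) {a..<b} =
      emeasure (interval_measure (\<lambda>x. - V (- x))) (uminus -` {a..<b} \<inter> UNIV)"
    unfolding left_interval_measure_def by (subst emeasure_distr) auto
  also have "uminus -` {a..<b} \<inter> UNIV = {- b<..- a}"
    by auto
  also have "emeasure (interval_measure (\<lambda>x. - V (- x))) {- b<..- a} = ennreal (V b - V a)"
    using assms cont by (subst emeasure_interval_measure_Ioc) (auto simp: mono_def)
  finally show ?thesis .
qed

text \<open>The torus is identified with \<open>{0..<1}\<close>. Elements of \<open>L2\<close> are represented by functions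
  \<open>real \<Rightarrow> real\<close>; their values outside \<open>{0..<1}\<close> are irrelevant, and equality in \<open>L2\<close> is equality
  almost everywhere with respect to \<open>torus_measure V\<close>.\<close>

definition torus_measure :: "(real \<Rightarrow> real) \<Rightarrow> real measure" where
  "torus_measure V = restrict_space (left_interval_measure V) {0..<1}"

definition L2 :: "'a measure \<Rightarrow> ('a \<Rightarrow> real) set" where
  "L2 M = {f \<in> borel_measurable M. integrable M (\<lambda>x. (f x)\<^sup>2)}"

definition iterated_integral ::
    "(real \<Rightarrow> real) \<Rightarrow> (real \<Rightarrow> real) \<Rightarrow> (real \<Rightarrow> real) \<Rightarrow> real \<Rightarrow> real" where
  "iterated_integral W V g x =
     (LINT y:{0<..x}|interval_measure W. (LINT s:{0..<y}|left_interval_measure V. g s))"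

text \<open>The graph of the Dirichlet Laplacian: pairs \<open>(f, g)\<close> with \<open>f\<close> in the domain and \<open>g\<close>
  its image.\<close>

definition dirichlet_laplacian ::
    "(real \<Rightarrow> real) \<Rightarrow> (real \<Rightarrow> real) \<Rightarrow> ((real \<Rightarrow> real) \<times> (real \<Rightarrow> real)) set" where
  "dirichlet_laplacian W V =
     {(f, g). f \<in> L2 (torus_measure V) \<and> g \<in> L2 (torus_measure V) \<and>
        (\<exists>b. (AE x in torus_measure V. f x = b * W x + iterated_integral W V g x) \<and>
             b * W 1 + iterated_integral W V g 1 = 0)}"

definition eigenspace :: "(real \<Rightarrow> real) \<Rightarrow> (real \<Rightarrow> real) \<Rightarrow> real \<Rightarrow> (real \<Rightarrow> real) set" where
  "eigenspace W V \<mu> =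
     {f. \<exists>g. (f, g) \<in> dirichlet_laplacian W V \<and> (AE x in torus_measure V. - g x = \<mu> * f x)}"

text \<open>Linear independence and dimension are taken modulo equality almost everywhere.\<close>

definition AE_independent :: "'a measure \<Rightarrow> nat \<Rightarrow> (nat \<Rightarrow> 'a \<Rightarrow> real) \<Rightarrow> bool" where
  "AE_independent M k f \<longleftrightarrow>
     (\<forall>c. (AE x in M. (\<Sum>i<k. c i * f i x) = 0) \<longrightarrow> (\<forall>i<k. c i = 0))"

definition AE_dim :: "'a measure \<Rightarrow> ('a \<Rightarrow> real) set \<Rightarrow> enat" where
  "AE_dim M E = Sup {enat k |k. \<exists>f. (\<forall>i<k. f i \<in> E) \<and> AE_independent M k f}"

definition ecard :: "'a set \<Rightarrow> enat" where
  "ecard A = (if finite A then enat (card A) else \<infinity>)"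

text \<open>\<open>ev\<close> lists, on the indices \<open>i \<ge> 1\<close> and in non-decreasing order, all eigenvalues of the negative
  Dirichlet Laplacian, each as often as its multiplicity. A number which is not an eigenvalue has
  multiplicity 0 and hence does not occur.\<close>

definition dirichlet_eigenvalues ::
    "(real \<Rightarrow> real) \<Rightarrow> (real \<Rightarrow> real) \<Rightarrow> (nat \<Rightarrow> real) \<Rightarrow> bool" where
  "dirichlet_eigenvalues W V ev \<longleftrightarrow>
     mono_on {1..} ev \<and>
     (\<forall>\<mu>. ecard {i. 1 \<le> i \<and> ev i = \<mu>} = AE_dim (torus_measure V) (eigenspace W V \<mu>))"

end

theory Submission
  imports Defs
begin

text \<open>
  The exponent \<open>\<rho> = 1/2\<close> works for all \<open>W\<close> and \<open>V\<close>: with \<open>T = W 1 + V 1\<close> one has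
  \<open>ev n \<ge> n\<^sup>2 / T\<^sup>2\<close>, and the series then converges for \<open>s > 1/2\<close> by comparison
  with \<open>\<Sum> n powr (-2 s)\<close>. The quadratic bound comes from the min-max principle, in the form
  that needs only eigenfunctions and no spectral theorem.

  Write \<open>M\<close> for \<open>dW\<close> on \<open>{0<..1}\<close> and \<open>N\<close> for \<open>dV\<close> on \<open>{0..<1}\<close>. An eigenfunction
  for \<open>\<mu>\<close> agrees almost everywhere with an \<open>F\<close> of the form
  \<open>F x = \<integral>\<^bsub>(0,x]\<^esub> G dM\<close>, where \<open>G y = b - \<mu> \<integral>\<^bsub>[0,y)\<^esub> F dN\<close> is the derivative of \<open>F\<close>
  with respect to \<open>W\<close>, and \<open>F 1 = 0\<close>. Fubini turns the boundary condition into the energy identity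
  \<open>\<integral> G\<^sub>i G\<^sub>j dM = \<mu>\<^sub>i \<integral> F\<^sub>i F\<^sub>j dN\<close> (\<open>energy_identity\<close>). Its left-hand side is symmetric,
  so eigenfunctions for different eigenvalues are orthogonal; hence \<open>n\<close> eigenfunctions that realise
  the multiplicities of \<open>ev 1, \<dots>, ev n\<close> are independent, and each of their combinations
  \<open>f\<close>, with derivative \<open>g\<close>, satisfies \<open>\<integral> g\<^sup>2 dM \<le> ev n \<integral> f\<^sup>2 dN\<close>
  (\<open>combination_energy_le\<close>).

  In the opposite direction, cut \<open>[0,1]\<close> at the quantiles \<open>0 = a\<^sub>0 \<le> \<dots> \<le> a\<^sub>n = 1\<close> of
  \<open>W + V\<close>, so that each open gap has mass at most \<open>T / n\<close> for both measures. Atoms may be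
  heavier than this, but they sit at the cut points. An \<open>n\<close>-dimensional space contains a nonzero
  \<open>f\<close> that vanishes at the \<open>n - 1\<close> points \<open>a\<^sub>1, \<dots>, a\<^bsub>n-1\<^esub>\<close>, and at \<open>a\<^sub>0 = 0\<close> every
  eigenfunction vanishes. Cauchy-Schwarz on each gap gives
  \<open>\<integral> f\<^sup>2 dN \<le> (T/n)\<^sup>2 \<integral> g\<^sup>2 dM\<close> (\<open>poincare_inequality\<close>): the atoms of \<open>N\<close> at the cut points
  are harmless because \<open>f\<close> is zero there. Both estimates together yield
  \<open>1 \<le> (T/n)\<^sup>2 ev n\<close>.
\<close>

section \<open>Linear equations, quantiles and integrals of products\<close>

text \<open>Gaussian elimination: the last equation either is trivial or expresses one unknown by the others.\<close>

lemma homogeneous_system_nontrivial_solution: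
  fixes A :: "'a \<Rightarrow> nat \<Rightarrow> 'b::field"
  assumes "finite S" and "m < card S"
  shows "\<exists>c. (\<exists>i\<in>S. c i \<noteq> 0) \<and> (\<forall>j<m. (\<Sum>i\<in>S. c i * A i j) = 0)"
  using assms
proof (induction m arbitrary: S A)
  case 0
  then obtain i where "i \<in> S" by (metis card_gt_0_iff equals0I)
  then show ?case by (intro exI[of _ "\<lambda>_. 1"]) auto
next
  case (Suc m)
  show ?case
  proof (cases "\<forall>i\<in>S. A i m = 0")
    case True
    obtain c where c: "\<exists>i\<in>S. c i \<noteq> 0" "\<forall>j<m. (\<Sum>i\<in>S. c i * A i j) = 0"
      using Suc.IH[of S A] Suc.prems by auto
    show ?thesis
      using c True by (intro exI[of _ c]) (auto simp: less_Suc_eq)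
  next
    case False
    then obtain p where p: "p \<in> S" "A p m \<noteq> 0" by auto
    \<comment> \<open>The coefficients that remain once the equation \<open>m\<close> is solved for the unknown \<open>p\<close>.\<close>
    define A' where "A' i j = A i j - A i m / A p m * A p j" for i j
    have "m < card (S - {p})" using Suc.prems p by simp
    then obtain c where c: "\<exists>i\<in>S - {p}. c i \<noteq> 0"
      "\<forall>j<m. (\<Sum>i\<in>S - {p}. c i * A' i j) = 0"
      using Suc.IH[of "S - {p}" A'] Suc.prems by auto
    define t where "t = - (\<Sum>i\<in>S - {p}. c i * (A i m / A p m))"
    have eq: "(\<Sum>i\<in>S. (c(p := t)) i * A i j) = (\<Sum>i\<in>S - {p}. c i * A' i j)" for j
    proof -
      have "(\<Sum>i\<in>S. (c(p := t)) i * A i j) = t * A p j + (\<Sum>i\<in>S - {p}. c i * A i j)"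
        using Suc.prems p by (subst sum.remove[of S p]) (auto intro!: sum.cong)
      also have "\<dots> = (\<Sum>i\<in>S - {p}. c i * A' i j)"
        by (simp add: t_def A'_def right_diff_distrib sum_subtractf sum_distrib_right mult.assoc)
      finally show ?thesis .
    qed
    have "A' i m = 0" for i using p by (simp add: A'_def)
    then have "\<forall>j<Suc m. (\<Sum>i\<in>S. (c(p := t)) i * A i j) = 0"
      unfolding eq using c(2) by (auto simp: less_Suc_eq)
    moreover have "\<exists>i\<in>S. (c(p := t)) i \<noteq> 0" using c(1) by auto
    ultimately show ?thesis by blast
  qed
qed

text \<open>The point \<open>a j\<close> is where \<open>H\<close> passes the fraction \<open>j / n\<close> of its total increase. Since \<open>H\<close> may
  jump across several such levels at once, points may coincide, and only the increase strictly
  between two neighbours is controlled.\<close>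

lemma quantile_partition:
  fixes H :: "real \<Rightarrow> real"
  assumes H: "strict_mono H" "H 0 = 0" and n: "0 < n"
  obtains a :: "nat \<Rightarrow> real" where "a 0 = 0" "a n = 1" "mono a"
    "\<And>j. a j \<in> {0..1}"
    "\<And>j x y. a j < x \<Longrightarrow> x \<le> y \<Longrightarrow> y < a (Suc j) \<Longrightarrow> H y - H x \<le> H 1 / n"
proof -
  define Q where "Q j = {x \<in> {0..1}. H x \<le> real j * H 1 / real n}" for j :: nat
  define a where "a j = Sup (Q j)" for j
  have le: "H x \<le> H y \<longleftrightarrow> x \<le> y" for x y using H by (simp add: strict_mono_less_eq)
  have H1: "0 \<le> H 1" using le[of 0 1] H by simp
  have bdd: "bdd_above (Q j)" for j unfolding Q_def by (rule bdd_aboveI[of _ 1]) auto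
  have zero: "0 \<in> Q j" for j using H1 H by (simp add: Q_def)
  have "Q 0 = {0}"
  proof (intro set_eqI iffI)
    fix x assume "x \<in> Q 0"
    then have "0 \<le> x" "H x \<le> H 0" using H by (auto simp: Q_def)
    with le[of x 0] show "x \<in> {0}" by simp
  qed (use zero in simp)
  then have a0: "a 0 = 0" by (simp add: a_def)
  have "Q n = {0..1}"
  proof (intro set_eqI iffI)
    fix x :: real assume "x \<in> {0..1}"
    moreover from this have "H x \<le> H 1" unfolding le by simp
    ultimately show "x \<in> Q n" using n by (simp add: Q_def)
  qed (simp add: Q_def)
  then have an: "a n = 1" by (simp add: a_def)
  have mono: "mono a"
  proof (rule monoI)
    fix i j :: nat assume "i \<le> j"
    then have "real i * H 1 / real n \<le> real j * H 1 / real n"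
      using H1 by (intro divide_right_mono mult_right_mono) auto
    then have "Q i \<subseteq> Q j" by (auto simp: Q_def)
    then show "a i \<le> a j"
      unfolding a_def using zero bdd by (intro cSup_subset_mono) auto
  qed
  have rng: "a j \<in> {0..1}" for j
  proof -
    have "0 \<le> a j" unfolding a_def by (rule cSup_upper[OF zero bdd])
    moreover have "a j \<le> 1" unfolding a_def
      by (rule cSup_least) (use zero in blast, simp add: Q_def)
    ultimately show ?thesis by simp
  qed
  have gap: "H y - H x \<le> H 1 / n" if "a j < x" "x \<le> y" "y < a (Suc j)" for j x y
  proof -
    have "0 < x" "x < 1" using that rng[of j] rng[of "Suc j"] by auto
    then have "x \<notin> Q j \<and> x \<in> {0..1}"
      using cSup_upper[OF _ bdd, of x j] that by (auto simp: a_def)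
    then have 1: "real j * H 1 / real n < H x" by (auto simp: Q_def)
    obtain z where "z \<in> Q (Suc j)" "y < z"
      using less_cSup_iff[of "Q (Suc j)" y] zero[of "Suc j"] bdd[of "Suc j"] \<open>y < a (Suc j)\<close>
      unfolding a_def by blast
    then have "H y \<le> real (Suc j) * H 1 / real n"
      using le[of y z] by (auto simp: Q_def)
    with 1 show ?thesis by (simp add: add_divide_distrib distrib_right)
  qed
  show thesis by (rule that[OF a0 an mono rng gap])
qed

text \<open>The gaps are disjoint; bounding by the indicator of \<open>{..<a m}\<close> instead of 1 makes the induction work.\<close>

lemma sum_indicator_gaps_le:
  fixes a :: "nat \<Rightarrow> real"
  assumes "mono a"
  shows "(\<Sum>j<m. indicator {a j<..<a (Suc j)} y) \<le> (indicator {..<a m} y :: real)"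
proof (induction m)
  case (Suc m)
  have "a m \<le> a (Suc m)" using assms by (simp add: monoD)
  have "(\<Sum>j<Suc m. indicator {a j<..<a (Suc j)} y) \<le>
      indicator {..<a m} y + (indicator {a m<..<a (Suc m)} y :: real)"
    using Suc by simp
  moreover have "indicator {..<a m} y + indicator {a m<..<a (Suc m)} y
      \<le> (indicator {..<a (Suc m)} y :: real)"
    using \<open>a m \<le> a (Suc m)\<close> by (auto split: split_indicator)
  ultimately show ?case by linarith
qed simp

lemma mono_sequence_bracket:
  fixes a :: "nat \<Rightarrow> real"
  assumes "a 0 \<le> x" "x < a n"
  obtains j where "j < n" "a j \<le> x" "x < a (Suc j)"
  using assms
proof (induction n arbitrary: thesis)
  case (Suc n)
  show ?case
  proof (cases "x < a n")
    case True
    then show ?thesis using Suc by (metis less_SucI)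
  next
    case False
    then show ?thesis using Suc.prems by (meson lessI not_less)
  qed
qed simp

lemma integral_sum_product:
  fixes f :: "'i \<Rightarrow> 'a \<Rightarrow> real"
  assumes "\<And>i j. i \<in> A \<Longrightarrow> j \<in> B \<Longrightarrow> integrable M (\<lambda>x. f i x * g j x)"
  shows "(LINT x|M. (\<Sum>i\<in>A. c i * f i x) * (\<Sum>j\<in>B. d j * g j x)) =
    (\<Sum>i\<in>A. \<Sum>j\<in>B. c i * d j * (LINT x|M. f i x * g j x))"
proof -
  have "(LINT x|M. (\<Sum>i\<in>A. c i * f i x) * (\<Sum>j\<in>B. d j * g j x)) =
      (LINT x|M. (\<Sum>i\<in>A. \<Sum>j\<in>B. c i * d j * (f i x * g j x)))"
    by (simp only: sum_product) (simp add: mult_ac)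
  then show ?thesis
    using assms by (simp add: Bochner_Integration.integral_sum)
qed

text \<open>The Cauchy-Schwarz inequality against the indicator of \<open>A\<close>. The quadratic polynomial
  \<open>t \<mapsto> \<integral>\<^bsub>A\<^esub> (f - t)\<^sup>2\<close> is nonnegative, so its discriminant is not positive.\<close>

lemma (in finite_measure) square_integral_indicator_le:
  fixes f :: "'a \<Rightarrow> real"
  assumes A: "A \<in> sets M" and f[measurable]: "f \<in> borel_measurable M"
    and B: "\<And>x. x \<in> space M \<Longrightarrow> \<bar>f x\<bar> \<le> B"
  shows "(LINT x|M. indicator A x * f x)\<^sup>2 \<le>
    measure M A * (LINT x|M. indicator A x * (f x)\<^sup>2)" (is "?I\<^sup>2 \<le> ?m * ?Q")
proof -
  note A[measurable]
  have i1: "integrable M (\<lambda>x. indicator A x * f x)"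
    by (rule integrable_const_bound[of _ "\<bar>B\<bar>"])
       (use B in \<open>auto simp: indicator_def intro: order_trans[OF _ abs_ge_self]\<close>)
  have "(f x)\<^sup>2 \<le> B\<^sup>2" if "x \<in> space M" for x
    using power_mono[OF B[OF that], of 2] by simp
  then have i2: "integrable M (\<lambda>x. indicator A x * (f x)\<^sup>2)"
    by (intro integrable_const_bound[of _ "B\<^sup>2"]) (auto simp: indicator_def)
  have i0: "integrable M (\<lambda>x. indicator A x :: real)"
    using A by (simp add: emeasure_eq_measure)
  have q: "0 \<le> ?Q - 2 * t * ?I + t\<^sup>2 * ?m" for t
  proof -
    have "0 \<le> (LINT x|M. indicator A x * (f x - t)\<^sup>2)"
      by (intro Bochner_Integration.integral_nonneg) (auto simp: indicator_def)
    also have "\<dots> = (LINT x|M. indicator A x * (f x)\<^sup>2 - 2 * t * (indicator A x * f x)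
        + t\<^sup>2 * indicator A x)"
      by (intro Bochner_Integration.integral_cong) (auto simp: power2_eq_square algebra_simps)
    also have "\<dots> = ?Q - 2 * t * ?I + t\<^sup>2 * ?m"
      using i0 i1 i2 A by simp
    finally show ?thesis .
  qed
  show ?thesis
  proof (cases "?m = 0")
    case True
    have "?I = 0"
    proof (rule ccontr)
      assume "?I \<noteq> 0"
      \<comment> \<open>The polynomial is affine in \<open>t\<close> here, and this \<open>t\<close> gives it the value \<open>-1\<close>.\<close>
      then have "?Q - 2 * ((?Q + 1) / (2 * ?I)) * ?I = -1" by (simp add: field_simps)
      with q[of "(?Q + 1) / (2 * ?I)"] True show False by simp
    qed
    with True show ?thesis by simp
  next
    case False
    then have m: "0 < ?m" using measure_nonneg[of M A] by linarith
    have "0 \<le> ?Q - ?I\<^sup>2 / ?m"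
      using q[of "?I / ?m"] m by (simp add: field_simps power2_eq_square)
    with m show ?thesis by (simp add: field_simps)
  qed
qed

section \<open>Bounded Borel functions\<close>

text \<open>On a finite measure all integrals of such functions exist, and the class is closed under every
  operation used below. This removes integrability questions for products of eigenfunctions.\<close>

definition bounded_borel :: "(real \<Rightarrow> real) \<Rightarrow> bool" where
  "bounded_borel f \<longleftrightarrow> f \<in> borel_measurable borel \<and> bounded (range f)"

lemma bounded_borelD [measurable_dest]: "bounded_borel f \<Longrightarrow> f \<in> borel_measurable borel"
  by (simp add: bounded_borel_def)

lemma bounded_borel_bound:
  assumes "bounded_borel f" obtains B where "0 \<le> B" "\<And>x. \<bar>f x\<bar> \<le> B"
proof -
  obtain B where B: "\<And>x. \<bar>f x\<bar> \<le> B"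
    using assms by (auto simp: bounded_borel_def bounded_iff)
  have "0 \<le> B" using B[of 0] by (meson abs_ge_zero order_trans)
  with B that show thesis by blast
qed

lemma bounded_borelI:
  assumes "f \<in> borel_measurable borel" "\<And>x. \<bar>f x\<bar> \<le> B"
  shows "bounded_borel f"
  using assms by (auto simp: bounded_borel_def bounded_iff)

lemma bounded_borel_mult:
  assumes "bounded_borel f" "bounded_borel g" shows "bounded_borel (\<lambda>x. f x * g x)"
proof -
  obtain A B where "0 \<le> A" "\<And>x. \<bar>f x\<bar> \<le> A" "0 \<le> B" "\<And>x. \<bar>g x\<bar> \<le> B"
    using assms by (metis bounded_borel_bound)
  then show ?thesis
    using assms by (intro bounded_borelI[of _ "A * B"]) (auto simp: abs_mult intro!: mult_mono
        borel_measurable_times bounded_borelD)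
qed

lemma bounded_borel_add:
  assumes "bounded_borel f" "bounded_borel g" shows "bounded_borel (\<lambda>x. f x + g x)"
proof -
  obtain A B where "\<And>x. \<bar>f x\<bar> \<le> A" "\<And>x. \<bar>g x\<bar> \<le> B"
    using assms by (metis bounded_borel_bound)
  then show ?thesis
    using assms by (intro bounded_borelI[of _ "A + B"])
      (auto intro!: borel_measurable_add bounded_borelD abs_triangle_ineq[THEN order_trans] add_mono)
qed

lemma bounded_borel_const: "bounded_borel (\<lambda>x. c)"
  by (rule bounded_borelI[of _ "\<bar>c\<bar>"]) auto

lemma bounded_borel_sum:
  assumes "\<And>i. i \<in> S \<Longrightarrow> bounded_borel (f i)"
  shows "bounded_borel (\<lambda>x. \<Sum>i\<in>S. c i * f i x)"
  using assms
  by (induction S rule: infinite_finite_induct)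
     (auto intro!: bounded_borel_add bounded_borel_mult bounded_borel_const)

lemma bounded_borel_if:
  assumes "bounded_borel f" "Measurable.pred borel P"
  shows "bounded_borel (\<lambda>x. if P x then f x else 0)"
proof -
  obtain B where "0 \<le> B" "\<And>x. \<bar>f x\<bar> \<le> B" using assms bounded_borel_bound by blast
  then show ?thesis using assms
    by (intro bounded_borelI[of _ B]) (auto intro!: measurable_If bounded_borelD)
qed

section \<open>Pairs of finite measures on the unit interval\<close>

text \<open>\<open>M\<close> plays the role of \<open>dW\<close> and \<open>N\<close> that of \<open>dV\<close>. Their sigma-algebras are required only to
  make the identity measurable, so that restrictions to subintervals are covered. The half-open
  intervals matter: an atom of \<open>M\<close> at 0 would destroy the boundary condition \<open>F 0 = 0\<close>.\<close>

locale string_measures = M: finite_measure M + N: finite_measure N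
  for M N :: "real measure" +
  assumes measurable_ident_M [measurable]: "(\<lambda>x. x) \<in> borel_measurable M"
    and measurable_ident_N [measurable]: "(\<lambda>x. x) \<in> borel_measurable N"
    and space_M: "\<And>y. y \<in> space M \<Longrightarrow> 0 < y \<and> y \<le> 1"
    and space_N: "\<And>x. x \<in> space N \<Longrightarrow> 0 \<le> x \<and> x < 1"
begin

lemma borel_measurable_M: "f \<in> borel_measurable borel \<Longrightarrow> f \<in> borel_measurable M"
  using measurable_compose[OF measurable_ident_M] .

lemma borel_measurable_N: "f \<in> borel_measurable borel \<Longrightarrow> f \<in> borel_measurable N"
  using measurable_compose[OF measurable_ident_N] .

lemma integrable_bounded_borel:
  assumes "bounded_borel f" shows "integrable M f" "integrable N f"
proof -
  obtain B where B: "\<And>x. \<bar>f x\<bar> \<le> B" using assms bounded_borel_bound by blast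
  show "integrable M f"
    using B borel_measurable_M[OF bounded_borelD[OF assms]]
    by (intro M.integrable_const_bound[of _ B]) auto
  show "integrable N f"
    using B borel_measurable_N[OF bounded_borelD[OF assms]]
    by (intro N.integrable_const_bound[of _ B]) auto
qed

lemma bounded_borel_integral_below:
  assumes g: "integrable N g"
  shows "bounded_borel (\<lambda>y. LINT s|N. (if s < y then g s else 0))"
proof (rule bounded_borelI)
  have [measurable]: "g \<in> borel_measurable N" using g by simp
  show "(\<lambda>y. LINT s|N. (if s < y then g s else 0)) \<in> borel_measurable borel"
    by (rule N.borel_measurable_lebesgue_integral) measurable
  show "\<bar>LINT s|N. (if s < y then g s else 0)\<bar> \<le> (LINT s|N. \<bar>g s\<bar>)" for y
    using g by (intro integral_abs_bound[THEN order_trans] integral_mono_AE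
        integrable_abs Bochner_Integration.integrable_bound[OF g]) auto
qed

lemma bounded_borel_integral_upto:
  assumes g: "bounded_borel g"
  shows "bounded_borel (\<lambda>x. LINT y|M. (if y \<le> x then g y else 0))"
proof -
  have i: "integrable M g" using g by (rule integrable_bounded_borel)
  have [measurable]: "g \<in> borel_measurable M" using i by simp
  show ?thesis
  proof (rule bounded_borelI)
    show "(\<lambda>y. LINT s|M. (if s \<le> y then g s else 0)) \<in> borel_measurable borel"
      by (rule M.borel_measurable_lebesgue_integral) measurable
    show "\<bar>LINT s|M. (if s \<le> y then g s else 0)\<bar> \<le> (LINT s|M. \<bar>g s\<bar>)" for y
      using i by (intro integral_abs_bound[THEN order_trans] integral_mono_AE
          integrable_abs Bochner_Integration.integrable_bound[OF i]) auto
  qed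
qed

section \<open>A Poincare inequality between zeros\<close>

text \<open>For \<open>x\<close> in the gap after \<open>a j\<close>, \<open>F x\<close> is the integral of \<open>G\<close> over \<open>(a j, x]\<close>, so Cauchy-Schwarz
  gives \<open>(F x)\<^sup>2 \<le> c \<integral> G\<^sup>2\<close> with the integral over the gap. Integrating over the gap
  costs another factor \<open>c\<close>, and the gaps are disjoint. The condition
  \<open>F (a j) = 0\<close> enters twice: it starts the integral, and it removes the
  atoms of \<open>N\<close> at the cut points.\<close>

lemma poincare_inequality:
  assumes G: "bounded_borel G"
    and F: "\<And>x. F x = (LINT y|M. (if y \<le> x then G y else 0))"
    and a: "mono a" "a 0 = 0" "a n = 1"
    and zero: "\<And>j. j < n \<Longrightarrow> F (a j) = 0"
    and mM: "\<And>j. j < n \<Longrightarrow> measure M (space M \<inter> {a j<..<a (Suc j)}) \<le> c"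
    and mN: "\<And>j. j < n \<Longrightarrow> measure N (space N \<inter> {a j<..<a (Suc j)}) \<le> c"
    and c: "0 \<le> c"
  shows "(LINT x|N. (F x)\<^sup>2) \<le> c\<^sup>2 * (LINT y|M. (G y)\<^sup>2)"
proof -
  define I where "I j = {a j<..<a (Suc j)}" for j
  define E where "E j = (LINT y|M. indicator (I j) y * (G y)\<^sup>2)" for j
  obtain B where B: "\<And>x. \<bar>G x\<bar> \<le> B" using G bounded_borel_bound by blast
  have [measurable]: "G \<in> borel_measurable borel" using G by (rule bounded_borelD)
  have [measurable]: "G \<in> borel_measurable M" by (rule borel_measurable_M) measurable
  have bF: "bounded_borel F" unfolding F using G by (rule bounded_borel_integral_upto)
  have bG2: "bounded_borel (\<lambda>y. (G y)\<^sup>2)" unfolding power2_eq_square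
    by (intro bounded_borel_mult G)
  have bF2: "bounded_borel (\<lambda>y. (F y)\<^sup>2)" unfolding power2_eq_square
    by (intro bounded_borel_mult bF)
  have bI: "bounded_borel (indicator (I j))" for j
    by (rule bounded_borelI[of _ 1]) (auto simp: I_def indicator_def)
  have iE: "integrable M (\<lambda>y. indicator (I j) y * (G y)\<^sup>2)" for j
    by (intro integrable_bounded_borel bounded_borel_mult bI bG2)
  have E0: "0 \<le> E j" for j unfolding E_def by (intro Bochner_Integration.integral_nonneg) auto
  have local: "(F x)\<^sup>2 \<le> c * E j" if j: "j < n" and x: "x \<in> I j" for x j
  proof -
    define J where "J = {y \<in> space M. a j < y \<and> y \<le> x}"
    have [measurable]: "J \<in> sets M" unfolding J_def by measurable
    have iu: "integrable M (\<lambda>y. if y \<le> t then G y else 0)" for t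
      by (intro integrable_bounded_borel bounded_borel_if G) measurable
    have "F x = F x - F (a j)" using zero j by simp
    also have "\<dots> = (LINT y|M. (if y \<le> x then G y else 0) - (if y \<le> a j then G y else 0))"
      unfolding F using iu by simp
    also have "\<dots> = (LINT y|M. indicator J y * G y)"
      using x by (intro Bochner_Integration.integral_cong) (auto simp: J_def I_def)
    finally have "(F x)\<^sup>2 \<le> measure M J * (LINT y|M. indicator J y * (G y)\<^sup>2)"
      using M.square_integral_indicator_le[of J G B] B by simp
    also have "\<dots> \<le> c * E j"
    proof (intro mult_mono)
      have "measure M J \<le> measure M (space M \<inter> {a j<..<a (Suc j)})"
      proof (rule M.finite_measure_mono)
        show "J \<subseteq> space M \<inter> {a j<..<a (Suc j)}" using x by (auto simp: J_def I_def)
        have "{y \<in> space M. a j < y \<and> y < a (Suc j)} \<in> sets M" by measurable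
        also have "{y \<in> space M. a j < y \<and> y < a (Suc j)} = space M \<inter> {a j<..<a (Suc j)}" by auto
        finally show "space M \<inter> {a j<..<a (Suc j)} \<in> sets M" .
      qed
      then show "measure M J \<le> c" using mM[OF j] by simp
      have "J = space M \<inter> {a j<..x}" by (auto simp: J_def)
      then have eq: "(LINT y|M. indicator J y * (G y)\<^sup>2) = (LINT y|M. indicator {a j<..x} y * (G y)\<^sup>2)"
        by (intro Bochner_Integration.integral_cong) (auto simp: indicator_def)
      have "bounded_borel (indicator {a j<..x})"
        by (rule bounded_borelI[of _ 1]) (auto simp: indicator_def)
      then show "(LINT y|M. indicator J y * (G y)\<^sup>2) \<le> E j"
        unfolding E_def eq using x
        by (intro integral_mono integrable_bounded_borel bounded_borel_mult bI bG2)
           (auto simp: I_def split: split_indicator)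
      show "0 \<le> (LINT y|M. indicator J y * (G y)\<^sup>2)"
        by (intro Bochner_Integration.integral_nonneg) auto
    qed (use c in auto)
    finally show ?thesis .
  qed
  have pw: "(F x)\<^sup>2 \<le> (\<Sum>j<n. (c * E j) * indicator (I j) x)" if x: "x \<in> space N" for x
  proof -
    obtain j where j: "j < n" "a j \<le> x" "x < a (Suc j)"
      using mono_sequence_bracket[of a x n] space_N[OF x] a by auto
    have nn: "0 \<le> (c * E i) * indicator (I i) x" for i using c E0 by simp
    show ?thesis
    proof (cases "x = a j")
      case True
      then have "(F x)\<^sup>2 = 0" using zero j by simp
      also have "\<dots> \<le> (\<Sum>j<n. (c * E j) * indicator (I j) x)" using nn by (rule sum_nonneg)
      finally show ?thesis .
    next
      case False
      then have xj: "x \<in> I j" using j by (auto simp: I_def)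
      have "(F x)\<^sup>2 \<le> (c * E j) * indicator (I j) x" using local[OF j(1) xj] xj by simp
      also have "\<dots> \<le> (\<Sum>j<n. (c * E j) * indicator (I j) x)"
        using j nn by (intro member_le_sum) auto
      finally show ?thesis .
    qed
  qed
  have "(LINT x|N. (F x)\<^sup>2) \<le> (LINT x|N. (\<Sum>j<n. (c * E j) * indicator (I j) x))"
    using pw by (intro integral_mono integrable_bounded_borel bF2 bounded_borel_sum bI) auto
  also have "\<dots> = (\<Sum>j<n. (c * E j) * measure N (space N \<inter> I j))"
    using integrable_bounded_borel(2)[OF bI]
    by (subst Bochner_Integration.integral_sum) (auto simp: Int_commute simp del: sum_mult_indicator)
  also have "\<dots> \<le> (\<Sum>j<n. (c * E j) * c)"
    using mN c E0 by (intro sum_mono mult_left_mono) (auto simp: I_def)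
  also have "\<dots> = c\<^sup>2 * (\<Sum>j<n. E j)"
    by (simp add: sum_distrib_left power2_eq_square mult_ac)
  also have "(\<Sum>j<n. E j) = (LINT y|M. (\<Sum>j<n. indicator (I j) y * (G y)\<^sup>2))"
    unfolding E_def by (rule Bochner_Integration.integral_sum[symmetric]) (rule iE)
  also have "\<dots> \<le> (LINT y|M. (G y)\<^sup>2)"
  proof (intro integral_mono Bochner_Integration.integrable_sum iE integrable_bounded_borel(1)[OF bG2])
    fix y
    have "(\<Sum>j<n. indicator (I j) y) \<le> (1::real)"
      unfolding I_def
      by (rule order_trans[OF sum_indicator_gaps_le[OF a(1)]]) (simp split: split_indicator)
    then have "(\<Sum>j<n. indicator (I j) y) * (G y)\<^sup>2 \<le> 1 * (G y)\<^sup>2"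
      by (rule mult_right_mono) simp
    then show "(\<Sum>j<n. indicator (I j) y * (G y)\<^sup>2) \<le> (G y)\<^sup>2"
      by (simp only: sum_distrib_right mult_1)
  qed
  finally show ?thesis using c by (simp add: mult_left_mono)
qed

section \<open>Eigenfunctions and the energy identity\<close>

text \<open>\<open>F\<close> is an eigenfunction given by an everywhere defined representative, and \<open>G\<close> is its derivative with
  respect to \<open>M\<close>. The eigenvalue equation appears in integrated form, as an equation for \<open>G\<close>.\<close>

definition eigenpair :: "real \<Rightarrow> (real \<Rightarrow> real) \<Rightarrow> (real \<Rightarrow> real) \<Rightarrow> bool" where
  "eigenpair \<mu> G F \<longleftrightarrow>
     bounded_borel G \<and> bounded_borel F \<and>
     (\<exists>b. \<forall>y. G y = b - \<mu> * (LINT s|N. (if s < y then F s else 0))) \<and>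
     (\<forall>x. F x = (LINT y|M. (if y \<le> x then G y else 0))) \<and> F 1 = 0"

lemma integral_exchange:
  assumes F: "bounded_borel F" and H: "bounded_borel H"
  shows "(LINT y|M. (LINT s|N. (if s < y then F s else 0)) * H y) =
    (LINT s|N. F s * (LINT y|M. (if s < y then H y else 0)))"
proof -
  interpret pair_sigma_finite N M ..
  interpret P: finite_measure "N \<Otimes>\<^sub>M M"
    by (rule finite_measure_pair_measure) unfold_locales
  obtain A where A: "0 \<le> A" "\<And>x. \<bar>F x\<bar> \<le> A" using F bounded_borel_bound by blast
  obtain B where B: "0 \<le> B" "\<And>x. \<bar>H x\<bar> \<le> B" using H bounded_borel_bound by blast
  have [measurable]: "F \<in> borel_measurable N" "H \<in> borel_measurable M"
    using F H by (auto intro: borel_measurable_N borel_measurable_M bounded_borelD)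
  let ?K = "\<lambda>s y. if s < y then F s * H y else 0"
  have int: "integrable (N \<Otimes>\<^sub>M M) (\<lambda>(s, y). ?K s y)"
    using A B by (intro P.integrable_const_bound[of _ "A * B"])
      (auto simp: abs_mult intro!: AE_I2 mult_mono)
  have "(LINT y|M. (LINT s|N. (if s < y then F s else 0)) * H y) = (LINT y|M. LINT s|N. ?K s y)"
    by (simp flip: integral_mult_left_zero add: if_distrib[of "\<lambda>z. z * H _"] cong: if_cong)
  also have "\<dots> = (LINT s|N. LINT y|M. ?K s y)"
    using Fubini_integral[OF int] .
  also have "\<dots> = (LINT s|N. F s * (LINT y|M. (if s < y then H y else 0)))"
    by (simp flip: integral_mult_right_zero add: if_distrib[of "\<lambda>z. F _ * z"] cong: if_cong)
  finally show ?thesis .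
qed

text \<open>Integration by parts. The constant in \<open>G\<close> is integrated against \<open>H\<close> and gives a multiple of
  \<open>K 1 = 0\<close>; the rest is an integral over \<open>s < y\<close>, and integrating \<open>H\<close> over \<open>y > s\<close> first
  gives \<open>K 1 - K s = - K s\<close>.\<close>

lemma energy_identity:
  assumes FG: "eigenpair \<mu> G F" and KH: "eigenpair \<nu> H K"
  shows "(LINT y|M. G y * H y) = \<mu> * (LINT x|N. F x * K x)"
proof -
  obtain b where b: "\<And>y. G y = b - \<mu> * (LINT s|N. (if s < y then F s else 0))"
    using FG by (auto simp: eigenpair_def)
  have F: "bounded_borel F" and H: "bounded_borel H" and K1: "K 1 = 0"
    and K: "\<And>x. K x = (LINT y|M. (if y \<le> x then H y else 0))"
    using FG KH by (auto simp: eigenpair_def)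
  have iH: "integrable M H" using H by (rule integrable_bounded_borel)
  have iu: "integrable M (\<lambda>y. if y \<le> t then H y else 0)" for t
    by (intro integrable_bounded_borel bounded_borel_if H) measurable
  have H0: "(LINT y|M. H y) = 0"
    using K1 unfolding K by (subst (asm) Bochner_Integration.integral_cong[OF refl, where g = H])
      (auto dest: space_M)
  have tail: "(LINT y|M. (if s < y then H y else 0)) = - K s" for s
  proof -
    have "(LINT y|M. (if s < y then H y else 0)) = (LINT y|M. H y - (if y \<le> s then H y else 0))"
      by (intro Bochner_Integration.integral_cong) auto
    also have "\<dots> = - K s" unfolding K using iH iu H0 by simp
    finally show ?thesis .
  qed
  have iF: "integrable M (\<lambda>y. (LINT s|N. (if s < y then F s else 0)) * H y)"
    using F H integrable_bounded_borel(2)[OF F]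
    by (intro integrable_bounded_borel bounded_borel_mult bounded_borel_integral_below)
  have "(LINT y|M. G y * H y) =
      (LINT y|M. b * H y - \<mu> * ((LINT s|N. (if s < y then F s else 0)) * H y))"
    unfolding b by (simp add: left_diff_distrib mult.assoc)
  also have "\<dots> = b * (LINT y|M. H y) - \<mu> * (LINT y|M. (LINT s|N. (if s < y then F s else 0)) * H y)"
    using iH iF by simp
  also have "\<dots> = \<mu> * (LINT x|N. F x * K x)"
    unfolding integral_exchange[OF F H] tail H0 by simp
  finally show ?thesis .
qed

text \<open>The energy on the left of \<open>energy_identity\<close> is symmetric in the two eigenpairs, so it equals both \<open>\<mu>\<close> and
  \<open>\<nu>\<close> times the inner product.\<close>

lemma eigenpair_orthogonal:
  assumes "eigenpair \<mu> G F" "eigenpair \<nu> H K" "\<mu> \<noteq> \<nu>"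
  shows "(LINT x|N. F x * K x) = 0"
  using energy_identity[OF assms(1,2)] energy_identity[OF assms(2,1)] assms(3)
  by (simp add: mult.commute)

text \<open>Independence within each eigenspace suffices: by orthogonality, the part \<open>P\<close> of a vanishing
  combination that belongs to one eigenvalue has inner product \<open>\<integral> P\<^sup>2\<close> with the whole
  combination, so \<open>P = 0\<close> almost everywhere.\<close>

lemma eigenpairs_independent:
  assumes S: "finite S" and e: "\<And>i. i \<in> S \<Longrightarrow> eigenpair (\<mu> i) (G i) (F i)"
    and ind: "\<And>\<nu> c. AE x in N. (\<Sum>i | i \<in> S \<and> \<mu> i = \<nu>. c i * F i x) = 0 \<Longrightarrow>
      \<forall>i\<in>S. \<mu> i = \<nu> \<longrightarrow> c i = 0"
    and zero: "AE x in N. (\<Sum>i\<in>S. c i * F i x) = 0"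
    and i: "i \<in> S"
  shows "c i = 0"
proof -
  let ?T = "{j \<in> S. \<mu> j = \<mu> i}"
  let ?P = "\<lambda>x. \<Sum>j\<in>?T. c j * F j x"
  have bF: "bounded_borel (F j)" if "j \<in> S" for j using e[OF that] by (simp add: eigenpair_def)
  have int: "integrable N (\<lambda>x. F j x * F k x)" if "j \<in> S" "k \<in> S" for j k
    using that by (intro integrable_bounded_borel bounded_borel_mult bF)
  have bP: "bounded_borel ?P" using bF by (intro bounded_borel_sum) auto
  have "(LINT x|N. ?P x * ?P x) =
      (\<Sum>j\<in>?T. \<Sum>k\<in>?T. c j * c k * (LINT x|N. F j x * F k x))"
    using int by (intro integral_sum_product) auto
  also have "\<dots> = (\<Sum>j\<in>?T. \<Sum>k\<in>S. c j * c k * (LINT x|N. F j x * F k x))"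
  proof (intro sum.cong[OF refl] sum.mono_neutral_left S ballI)
    fix j k assume "j \<in> ?T" "k \<in> S - ?T"
    then show "c j * c k * (LINT x|N. F j x * F k x) = 0"
      using eigenpair_orthogonal[OF e[of j] e[of k]] by auto
  qed auto
  also have "\<dots> = (LINT x|N. ?P x * (\<Sum>k\<in>S. c k * F k x))"
    using int by (intro integral_sum_product[symmetric]) auto
  also have "\<dots> = (LINT x|N. 0)"
    using zero by (intro integral_cong_AE borel_measurable_N bounded_borelD bounded_borel_mult bP
        bounded_borel_sum bounded_borel_const bF) auto
  finally have "(LINT x|N. ?P x * ?P x) = 0" by simp
  then have "AE x in N. ?P x = 0"
    by (subst (asm) integral_nonneg_eq_0_iff_AE)
       (auto intro!: integrable_bounded_borel bounded_borel_mult bP)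
  then show ?thesis using ind[where \<nu> = "\<mu> i" and c = c] i by auto
qed

text \<open>The right-hand side minus the left-hand side is
  \<open>\<Sum>\<^bsub>i,j\<^esub> c\<^sub>i c\<^sub>j (\<Lambda> - \<mu>\<^sub>i) \<integral> F\<^sub>i F\<^sub>j\<close>. Only terms with \<open>\<mu>\<^sub>i = \<mu>\<^sub>j\<close> survive, and in those
  the factor \<open>\<Lambda> - \<mu>\<^sub>i\<close> can be split into two square roots. Hence it is the squared
  norm of \<open>\<Sum>\<^sub>i c\<^sub>i sqrt (\<Lambda> - \<mu>\<^sub>i) F\<^sub>i\<close>, and eigenvalues need not be grouped.\<close>

lemma combination_energy_le:
  assumes S: "finite S" and e: "\<And>i. i \<in> S \<Longrightarrow> eigenpair (\<mu> i) (G i) (F i)"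
    and le: "\<And>i. i \<in> S \<Longrightarrow> \<mu> i \<le> \<Lambda>"
  shows "(LINT y|M. (\<Sum>i\<in>S. c i * G i y)\<^sup>2) \<le> \<Lambda> * (LINT x|N. (\<Sum>i\<in>S. c i * F i x)\<^sup>2)"
proof -
  let ?ip = "\<lambda>i j. LINT x|N. F i x * F j x"
  have bF: "bounded_borel (F j)" and bG: "bounded_borel (G j)" if "j \<in> S" for j
    using e[OF that] by (simp_all add: eigenpair_def)
  have iF: "integrable N (\<lambda>x. F j x * F k x)" and iG: "integrable M (\<lambda>x. G j x * G k x)"
    if "j \<in> S" "k \<in> S" for j k
    using that by (auto intro!: integrable_bounded_borel bounded_borel_mult bF bG)
  define d where "d i = c i * sqrt (\<Lambda> - \<mu> i)" for i
  have "0 \<le> (LINT x|N. (\<Sum>i\<in>S. d i * F i x) * (\<Sum>i\<in>S. d i * F i x))"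
    by (intro Bochner_Integration.integral_nonneg) auto
  also have "\<dots> = (\<Sum>i\<in>S. \<Sum>j\<in>S. d i * d j * ?ip i j)"
    using iF by (intro integral_sum_product) auto
  also have "\<dots> = (\<Sum>i\<in>S. \<Sum>j\<in>S. \<Lambda> * (c i * c j * ?ip i j) - c i * c j * (\<mu> i * ?ip i j))"
  proof (intro sum.cong refl)
    fix i j assume ij: "i \<in> S" "j \<in> S"
    show "d i * d j * ?ip i j = \<Lambda> * (c i * c j * ?ip i j) - c i * c j * (\<mu> i * ?ip i j)"
    proof (cases "\<mu> i = \<mu> j")
      case True
      then have "d i * d j = c i * c j * (\<Lambda> - \<mu> i)"
        using le[OF ij(1)] by (simp add: d_def algebra_simps)
      then have "d i * d j * ?ip i j = c i * c j * (\<Lambda> - \<mu> i) * ?ip i j" by simp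
      then show ?thesis by (simp only:) (simp add: algebra_simps)
    next
      case False
      then show ?thesis using eigenpair_orthogonal[OF e e] ij by simp
    qed
  qed
  also have "\<dots> = \<Lambda> * (\<Sum>i\<in>S. \<Sum>j\<in>S. c i * c j * ?ip i j) -
      (\<Sum>i\<in>S. \<Sum>j\<in>S. c i * c j * (\<mu> i * ?ip i j))"
    by (simp add: sum_subtractf sum_distrib_left)
  also have "(\<Sum>i\<in>S. \<Sum>j\<in>S. c i * c j * ?ip i j) = (LINT x|N. (\<Sum>i\<in>S. c i * F i x)\<^sup>2)"
    unfolding power2_eq_square using iF by (intro integral_sum_product[symmetric]) auto
  also have "(\<Sum>i\<in>S. \<Sum>j\<in>S. c i * c j * (\<mu> i * ?ip i j)) =
      (\<Sum>i\<in>S. \<Sum>j\<in>S. c i * c j * (LINT y|M. G i y * G j y))"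
    using energy_identity[OF e e] by (intro sum.cong refl) simp
  also have "\<dots> = (LINT y|M. (\<Sum>i\<in>S. c i * G i y)\<^sup>2)"
    unfolding power2_eq_square using iG by (intro integral_sum_product[symmetric]) auto
  finally show ?thesis by simp
qed

text \<open>The min-max argument: a combination that vanishes at all cut points is tested in
  \<open>poincare_inequality\<close> and in \<open>combination_energy_le\<close>.\<close>

lemma eigenvalue_lower_bound:
  assumes S: "finite S" "S \<noteq> {}" and e: "\<And>i. i \<in> S \<Longrightarrow> eigenpair (\<mu> i) (G i) (F i)"
    and le: "\<And>i. i \<in> S \<Longrightarrow> \<mu> i \<le> \<Lambda>"
    and ind: "\<And>\<nu> c. AE x in N. (\<Sum>i | i \<in> S \<and> \<mu> i = \<nu>. c i * F i x) = 0 \<Longrightarrow>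
      \<forall>i\<in>S. \<mu> i = \<nu> \<longrightarrow> c i = 0"
    and a: "mono a" "a 0 = 0" "a (card S) = 1"
    and mM: "\<And>j. j < card S \<Longrightarrow> measure M (space M \<inter> {a j<..<a (Suc j)}) \<le> r"
    and mN: "\<And>j. j < card S \<Longrightarrow> measure N (space N \<inter> {a j<..<a (Suc j)}) \<le> r"
    and r: "0 \<le> r"
  shows "1 \<le> r\<^sup>2 * \<Lambda>"
proof -
  let ?n = "card S"
  \<comment> \<open>Only \<open>n - 1\<close> zeros have to be arranged: \<open>F i 0 = 0\<close> holds since \<open>M\<close> lives on \<open>(0, 1]\<close>.\<close>
  have n: "?n - 1 < ?n" using S by (simp add: card_gt_0_iff)
  obtain c where c: "\<exists>i\<in>S. c i \<noteq> 0" "\<forall>j<?n - 1. (\<Sum>i\<in>S. c i * F i (a (Suc j))) = 0"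
    using homogeneous_system_nontrivial_solution[OF S(1) n, of "\<lambda>i j. F i (a (Suc j))"] by auto
  define f where "f x = (\<Sum>i\<in>S. c i * F i x)" for x
  define g where "g x = (\<Sum>i\<in>S. c i * G i x)" for x
  have bF: "bounded_borel (F j)" and bG: "bounded_borel (G j)"
    and FG: "F j x = (LINT y|M. (if y \<le> x then G j y else 0))" if "j \<in> S" for j x
    using e[OF that] by (auto simp: eigenpair_def)
  have bf: "bounded_borel f" unfolding f_def using bF by (intro bounded_borel_sum) auto
  have bg: "bounded_borel g" unfolding g_def using bG by (intro bounded_borel_sum) auto
  have fg: "f x = (LINT y|M. (if y \<le> x then g y else 0))" for x
  proof -
    have "(LINT y|M. (if y \<le> x then g y else 0)) =
        (LINT y|M. (\<Sum>i\<in>S. c i * (if y \<le> x then G i y else 0)))"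
      by (intro Bochner_Integration.integral_cong) (auto simp: g_def)
    also have "\<dots> = (\<Sum>i\<in>S. c i * (LINT y|M. (if y \<le> x then G i y else 0)))"
      by (subst Bochner_Integration.integral_sum)
         (auto intro!: integrable_bounded_borel bounded_borel_mult bounded_borel_const
            bounded_borel_if bG)
    also have "\<dots> = f x" unfolding f_def using FG by (intro sum.cong) auto
    finally show ?thesis ..
  qed
  have f0: "f 0 = 0" unfolding fg
    by (subst Bochner_Integration.integral_cong[OF refl, where g = "\<lambda>_. 0"])
       (auto dest: space_M)
  have zero: "f (a j) = 0" if "j < ?n" for j
    using that c(2) f0 a(2) by (cases j) (auto simp: f_def)
  have "(LINT x|N. (f x)\<^sup>2) \<le> r\<^sup>2 * (LINT y|M. (g y)\<^sup>2)"
    by (rule poincare_inequality[OF bg fg a zero mM mN r])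
  also have "\<dots> \<le> r\<^sup>2 * (\<Lambda> * (LINT x|N. (f x)\<^sup>2))"
    unfolding f_def g_def using combination_energy_le[OF S(1) e le] by (intro mult_left_mono) auto
  finally have key: "(LINT x|N. (f x)\<^sup>2) \<le> (r\<^sup>2 * \<Lambda>) * (LINT x|N. (f x)\<^sup>2)"
    by (simp add: mult.assoc)
  have "0 < (LINT x|N. (f x)\<^sup>2)"
  proof (rule ccontr)
    assume "\<not> 0 < (LINT x|N. (f x)\<^sup>2)"
    moreover have "0 \<le> (LINT x|N. (f x)\<^sup>2)" by (intro Bochner_Integration.integral_nonneg) auto
    ultimately have "(LINT x|N. f x * f x) = 0" unfolding power2_eq_square by linarith
    then have "AE x in N. f x = 0"
      by (subst (asm) integral_nonneg_eq_0_iff_AE)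
         (auto intro!: integrable_bounded_borel bounded_borel_mult bf)
    then have "AE x in N. (\<Sum>i\<in>S. c i * F i x) = 0" by (simp add: f_def)
    then show False using eigenpairs_independent[OF S(1) e ind, where c = c] c(1) by blast
  qed
  with key show ?thesis by simp
qed

end

section \<open>Multiplicities and independent families\<close>

lemma AE_independent_mono:
  assumes "AE_independent M k' f" "k \<le> k'"
  shows "AE_independent M k f"
  unfolding AE_independent_def
proof (intro allI impI)
  fix c i assume ae: "AE x in M. (\<Sum>i<k. c i * f i x) = 0" and i: "i < k"
  define d where "d j = (if j < k then c j else 0)" for j
  have "(\<Sum>j<k'. d j * f j x) = (\<Sum>j<k. c j * f j x)" for x
    using assms(2) by (intro sum.mono_neutral_cong_right) (auto simp: d_def)
  with ae have "AE x in M. (\<Sum>j<k'. d j * f j x) = 0" by simp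
  then have "d i = 0" using assms i by (auto simp: AE_independent_def)
  then show "c i = 0" using i by (simp add: d_def)
qed

text \<open>For \<open>k > 0\<close> the supremum exceeds \<open>k - 1\<close>, so some independent family has at least \<open>k\<close> members,
  and it can be cut down to \<open>k\<close>.\<close>

lemma AE_dim_geD:
  assumes "enat k \<le> AE_dim M E"
  shows "\<exists>f. (\<forall>i<k. f i \<in> E) \<and> AE_independent M k f"
proof (cases k)
  case 0
  then show ?thesis by (auto simp: AE_independent_def)
next
  case (Suc m)
  then have "enat m < AE_dim M E"
    using assms by (metis enat_ord_simps(2) lessI less_le_trans)
  then obtain k' f where "enat m < enat k'" "\<forall>i<k'. f i \<in> E" "AE_independent M k' f"
    unfolding AE_dim_def less_Sup_iff by blast
  then show ?thesis using Suc AE_independent_mono[of M k' f k] by (intro exI[of _ f]) auto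
qed

text \<open>For each eigenvalue, the indices \<open>i \<le> n\<close> carrying it are matched with an independent family in its
  eigenspace. Nothing is claimed across eigenvalues; orthogonality provides that.\<close>

lemma eigenfunction_family:
  assumes "dirichlet_eigenvalues W V ev"
  obtains f where "\<And>i. i \<in> {1..n} \<Longrightarrow> f i \<in> eigenspace W V (ev i)"
    and "\<And>\<nu> c. AE x in torus_measure V. (\<Sum>i | i \<in> {1..n} \<and> ev i = \<nu>. c i * f i x) = 0 \<Longrightarrow>
      \<forall>i\<in>{1..n}. ev i = \<nu> \<longrightarrow> c i = 0"
proof -
  define S where "S \<nu> = {i. i \<in> {1..n} \<and> ev i = \<nu>}" for \<nu>
  have fin: "finite (S \<nu>)" for \<nu> by (simp add: S_def)
  have "\<exists>\<phi>. (\<forall>l<card (S \<nu>). \<phi> l \<in> eigenspace W V \<nu>) \<and>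
      AE_independent (torus_measure V) (card (S \<nu>)) \<phi>" for \<nu>
  proof (rule AE_dim_geD)
    have "enat (card (S \<nu>)) \<le> ecard {i. 1 \<le> i \<and> ev i = \<nu>}"
      unfolding ecard_def by (auto simp: S_def intro!: card_mono)
    then show "enat (card (S \<nu>)) \<le> AE_dim (torus_measure V) (eigenspace W V \<nu>)"
      using assms by (simp add: dirichlet_eigenvalues_def)
  qed
  then obtain \<phi> where \<phi>: "\<And>\<nu> l. l < card (S \<nu>) \<Longrightarrow> \<phi> \<nu> l \<in> eigenspace W V \<nu>"
    and ind: "\<And>\<nu>. AE_independent (torus_measure V) (card (S \<nu>)) (\<phi> \<nu>)"
    by metis
  have "\<exists>h. bij_betw h (S \<nu>) {..<card (S \<nu>)}" for \<nu>
    using ex_bij_betw_finite_nat[OF fin[of \<nu>]] by (simp add: atLeast0LessThan)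
  then obtain h where h: "\<And>\<nu>. bij_betw (h \<nu>) (S \<nu>) {..<card (S \<nu>)}" by metis
  define f where "f i = \<phi> (ev i) (h (ev i) i)" for i
  show thesis
  proof (rule that)
    fix i assume "i \<in> {1..n}"
    then have "i \<in> S (ev i)" by (simp add: S_def)
    then show "f i \<in> eigenspace W V (ev i)"
      unfolding f_def using h[of "ev i"] by (intro \<phi>) (auto dest: bij_betwE)
  next
    fix \<nu> c
    assume ae: "AE x in torus_measure V. (\<Sum>i | i \<in> {1..n} \<and> ev i = \<nu>. c i * f i x) = 0"
    define d where "d l = c (inv_into (S \<nu>) (h \<nu>) l)" for l
    have dh: "d (h \<nu> i) = c i" if "i \<in> S \<nu>" for i
      using that h[of \<nu>] by (simp add: d_def bij_betw_inv_into_left)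
    have "(\<Sum>l<card (S \<nu>). d l * \<phi> \<nu> l x) = (\<Sum>i\<in>S \<nu>. c i * f i x)" for x
    proof -
      have "(\<Sum>l<card (S \<nu>). d l * \<phi> \<nu> l x) = (\<Sum>i\<in>S \<nu>. d (h \<nu> i) * \<phi> \<nu> (h \<nu> i) x)"
        by (rule sum.reindex_bij_betw[OF h, symmetric])
      also have "\<dots> = (\<Sum>i\<in>S \<nu>. c i * f i x)"
        by (intro sum.cong refl) (use dh in \<open>auto simp: f_def S_def\<close>)
      finally show ?thesis .
    qed
    then have "AE x in torus_measure V. (\<Sum>l<card (S \<nu>). d l * \<phi> \<nu> l x) = 0"
      using ae by (simp add: S_def)
    then have "\<forall>l<card (S \<nu>). d l = 0" using ind[of \<nu>] by (auto simp: AE_independent_def)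
    then show "\<forall>i\<in>{1..n}. ev i = \<nu> \<longrightarrow> c i = 0"
      using dh h[of \<nu>] by (force simp: S_def dest: bij_betwE)
  qed
qed

section \<open>The measures of a pair of monotone functions\<close>

text \<open>Open intervals \<open>{x<..<y}\<close> lie in both \<open>{x<..y}\<close> and \<open>{x..<y}\<close>, so bounds on increments of
  right- and of left-continuous functions can both be fed into this exhaustion from inside.\<close>

lemma measure_open_interval_le:
  fixes K :: "real measure"
  assumes sets: "sets K = sets borel" and fin: "emeasure K {a<..<b} \<noteq> \<infinity>" and c: "0 \<le> c"
    and le: "\<And>x y. a < x \<Longrightarrow> x \<le> y \<Longrightarrow> y < b \<Longrightarrow> measure K {x<..<y} \<le> c"
  shows "measure K {a<..<b} \<le> c"
proof -
  define A where "A k = {a + 1 / real (Suc k)<..<b - 1 / real (Suc k)}" for k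
  have U: "(\<Union>k. A k) = {a<..<b}"
  proof (intro set_eqI iffI)
    fix x assume "x \<in> {a<..<b}"
    then obtain k where "1 / real (Suc k) < min (x - a) (b - x)"
      using nat_approx_posE[of "min (x - a) (b - x)"] by auto
    then show "x \<in> (\<Union>k. A k)" by (auto simp: A_def intro!: exI[of _ k])
  next
    fix x assume "x \<in> (\<Union>k. A k)"
    then obtain k where "a + 1 / real (Suc k) < x" "x < b - 1 / real (Suc k)"
      by (auto simp: A_def)
    moreover have "0 < 1 / real (Suc k)" by simp
    ultimately show "x \<in> {a<..<b}" unfolding greaterThanLessThan_iff by linarith
  qed
  have inc: "incseq A"
  proof (rule incseq_SucI)
    fix k
    have "1 / real (Suc (Suc k)) \<le> 1 / real (Suc k)" by (rule divide_left_mono) auto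
    then show "A k \<subseteq> A (Suc k)" unfolding A_def by (auto simp del: of_nat_Suc)
  qed
  have "(\<lambda>k. measure K (A k)) \<longlonglongrightarrow> measure K (\<Union>k. A k)"
    using fin U by (intro Lim_measure_incseq inc) (auto simp: sets A_def)
  moreover have "measure K (A k) \<le> c" for k
  proof (cases "a + 1 / real (Suc k) \<le> b - 1 / real (Suc k)")
    case True
    then show ?thesis unfolding A_def by (intro le) auto
  next
    case False
    then have "A k = {}" unfolding A_def by auto
    then show ?thesis using c by simp
  qed
  ultimately show ?thesis unfolding U by (intro LIMSEQ_le_const2[where a = c]) auto
qed

lemma sets_left_interval_measure [simp, measurable_cong]:
  "sets (left_interval_measure V) = sets borel"
  by (simp add: left_interval_measure_def)

lemma space_left_interval_measure [simp]: "space (left_interval_measure V) = UNIV"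
  by (simp add: left_interval_measure_def)

lemma emeasure_interval_measure_cadlag:
  assumes "mono W" "cadlag W" "a \<le> b"
  shows "emeasure (interval_measure W) {a<..b} = ennreal (W b - W a)"
  using assms by (intro emeasure_interval_measure_Ioc) (auto simp: mono_def cadlag_def)

locale string_functions =
  fixes W V :: "real \<Rightarrow> real"
  assumes W: "mono W" "cadlag W" "W 0 = 0" and V: "mono V" "caglad V" "V 0 = 0"
begin

definition dW :: "real measure" where
  "dW = restrict_space (interval_measure W) {0<..1}"

lemma space_dW: "space dW = {0<..1}" and space_torus: "space (torus_measure V) = {0..<1}"
  by (simp_all add: dW_def torus_measure_def space_restrict_space)

sublocale string_measures dW "torus_measure V"
proof -
  have "emeasure dW (space dW) = ennreal (W 1 - W 0)"
    using W by (simp add: space_dW) (simp add: dW_def emeasure_restrict_space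
        emeasure_interval_measure_cadlag)
  then have 1: "finite_measure dW" by (intro finite_measureI) simp
  have "emeasure (torus_measure V) (space (torus_measure V)) = ennreal (V 1 - V 0)"
    using V by (simp add: space_torus) (simp add: torus_measure_def emeasure_restrict_space
        emeasure_left_interval_measure)
  then have 2: "finite_measure (torus_measure V)" by (intro finite_measureI) simp
  have "(\<lambda>x. x) \<in> borel_measurable dW" "(\<lambda>x. x) \<in> borel_measurable (torus_measure V)"
    unfolding dW_def torus_measure_def by (auto intro!: measurable_restrict_space1)
  with 1 2 show "string_measures dW (torus_measure V)"
    by (auto simp: string_measures_def string_measures_axioms_def space_dW space_torus)
qed

text \<open>Both \<open>W\<close> and \<open>V\<close> increase by at most as much as \<open>W + V\<close>, so quantiles of the sum control both
  measures.\<close>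

lemma measure_gap_le:
  assumes ab: "0 \<le> a" "b \<le> 1" and c: "0 \<le> c"
    and le: "\<And>x y. a < x \<Longrightarrow> x \<le> y \<Longrightarrow> y < b \<Longrightarrow> (W y + V y) - (W x + V x) \<le> c"
  shows "measure dW (space dW \<inter> {a<..<b}) \<le> c"
    and "measure (torus_measure V) (space (torus_measure V) \<inter> {a<..<b}) \<le> c"
proof -
  have mW: "W x \<le> W y" and mV: "V x \<le> V y" if "x \<le> y" for x y
    using W V that by (auto dest: monoD)
  have "emeasure (interval_measure W) {a<..<b} \<le> emeasure (interval_measure W) {0<..1}"
    using ab by (intro emeasure_mono) auto
  also have "\<dots> < \<infinity>" using W by (simp add: emeasure_interval_measure_cadlag)
  finally have finW: "emeasure (interval_measure W) {a<..<b} \<noteq> \<infinity>" by simp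
  have "measure (interval_measure W) {a<..<b} \<le> c"
  proof (rule measure_open_interval_le[OF _ finW c])
    fix x y assume xy: "a < x" "x \<le> y" "y < b"
    have "emeasure (interval_measure W) {x<..<y} \<le> emeasure (interval_measure W) {x<..y}"
      by (intro emeasure_mono) auto
    also have "\<dots> = ennreal (W y - W x)"
      using W xy by (simp add: emeasure_interval_measure_cadlag)
    also have "\<dots> \<le> ennreal c" using le[OF xy] mV[OF xy(2)] by (intro ennreal_leI) simp
    finally show "measure (interval_measure W) {x<..<y} \<le> c"
      unfolding measure_def by (intro enn2real_leI c)
  qed simp
  moreover have "space dW \<inter> {a<..<b} = {a<..<b}" using ab by (auto simp: space_dW)
  ultimately show "measure dW (space dW \<inter> {a<..<b}) \<le> c"
    using ab by (simp add: dW_def measure_restrict_space subset_eq)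
  have "emeasure (left_interval_measure V) {a<..<b} \<le> emeasure (left_interval_measure V) {0..<1}"
    using ab by (intro emeasure_mono) auto
  also have "\<dots> < \<infinity>" using V by (simp add: emeasure_left_interval_measure)
  finally have finV: "emeasure (left_interval_measure V) {a<..<b} \<noteq> \<infinity>" by simp
  have "measure (left_interval_measure V) {a<..<b} \<le> c"
  proof (rule measure_open_interval_le[OF _ finV c])
    fix x y assume xy: "a < x" "x \<le> y" "y < b"
    have "emeasure (left_interval_measure V) {x<..<y} \<le> emeasure (left_interval_measure V) {x..<y}"
      by (intro emeasure_mono) auto
    also have "\<dots> = ennreal (V y - V x)"
      using V xy by (simp add: emeasure_left_interval_measure)
    also have "\<dots> \<le> ennreal c" using le[OF xy] mW[OF xy(2)] by (intro ennreal_leI) simp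
    finally show "measure (left_interval_measure V) {x<..<y} \<le> c"
      unfolding measure_def by (intro enn2real_leI c)
  qed simp
  moreover have "space (torus_measure V) \<inter> {a<..<b} = {a<..<b}" using ab by (auto simp: space_torus)
  ultimately show "measure (torus_measure V) (space (torus_measure V) \<inter> {a<..<b}) \<le> c"
    using ab by (simp add: torus_measure_def measure_restrict_space subset_eq)
qed

text \<open>On \<open>{0..1}\<close> the integrals over subsets of the line become integrals against \<open>dW\<close> and the torus
  measure; the linear term is absorbed because \<open>b W(x) = \<integral>\<^bsub>(0,x]\<^esub> b dW\<close>.\<close>

lemma iterated_integral_eq:
  assumes x: "x \<in> {0..1}" and g: "integrable (torus_measure V) g"
  shows "b * W x + iterated_integral W V g x =
    (LINT y|dW. (if y \<le> x then b + (LINT s|torus_measure V. (if s < y then g s else 0)) else 0))"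
proof -
  let ?q = "\<lambda>y. LINT s|torus_measure V. (if s < y then g s else 0)"
  have q: "?q y = (LINT s:{0..<y}|left_interval_measure V. g s)" if "y \<le> 1" for y
    using that unfolding torus_measure_def set_lebesgue_integral_def
    by (subst integral_restrict_space)
       (auto intro!: Bochner_Integration.integral_cong simp: indicator_def)
  have it: "iterated_integral W V g x = (LINT y|dW. (if y \<le> x then ?q y else 0))"
    using x q unfolding iterated_integral_def dW_def set_lebesgue_integral_def[of "interval_measure W"]
    by (subst integral_restrict_space)
       (auto intro!: Bochner_Integration.integral_cong simp: indicator_def)
  have lin: "b * W x = (LINT y|dW. (if y \<le> x then b else 0))"
  proof -
    have "(LINT y|dW. (if y \<le> x then b else 0)) = (LINT y|interval_measure W. b * indicator {0<..x} y)"
      using x unfolding dW_def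
      by (subst integral_restrict_space)
         (simp, rule Bochner_Integration.integral_cong, auto simp: indicator_def)
    also have "\<dots> = b * W x"
      using W x monoD[OF W(1), of 0 x]
      by (simp add: measure_def emeasure_interval_measure_cadlag)
    finally show ?thesis ..
  qed
  have int: "integrable dW (\<lambda>y. if y \<le> x then b else 0)"
    "integrable dW (\<lambda>y. if y \<le> x then ?q y else 0)"
    by (intro integrable_bounded_borel bounded_borel_if bounded_borel_const
        bounded_borel_integral_below g; measurable)+
  show ?thesis
    unfolding it lin Bochner_Integration.integral_add[OF int, symmetric]
    by (intro Bochner_Integration.integral_cong) auto
qed

text \<open>Elements of the eigenspace are classes modulo null sets. The defining formula itself selects the
  representative \<open>F\<close>; it depends on \<open>g\<close> only up to null sets, so there \<open>g\<close> may be replaced by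
  \<open>- \<mu> F\<close>.\<close>

lemma eigenspace_imp_eigenpair:
  assumes "f \<in> eigenspace W V \<mu>"
  obtains G F where "eigenpair \<mu> G F" "AE x in torus_measure V. f x = F x"
proof -
  obtain g b where g: "g \<in> L2 (torus_measure V)"
    and f: "AE x in torus_measure V. f x = b * W x + iterated_integral W V g x"
    and one: "b * W 1 + iterated_integral W V g 1 = 0"
    and gf: "AE x in torus_measure V. - g x = \<mu> * f x"
    using assms by (auto simp: eigenspace_def dirichlet_laplacian_def)
  have ig: "integrable (torus_measure V) g"
  proof (rule Bochner_Integration.integrable_bound)
    show "integrable (torus_measure V) (\<lambda>x. 1 + (g x)\<^sup>2)" using g by (simp add: L2_def)
    \<comment> \<open>The torus has finite mass, so square integrable functions are integrable.\<close>
    have "\<bar>t\<bar> \<le> \<bar>1 + t\<^sup>2\<bar>" for t :: real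
      using zero_le_power2[of "\<bar>t\<bar> - 1"] zero_le_power2[of t] by (simp add: power2_diff)
    then show "AE x in torus_measure V. norm (g x) \<le> norm (1 + (g x)\<^sup>2)" by simp
  qed (use g in \<open>simp add: L2_def\<close>)
  define G where "G y = b + (LINT s|torus_measure V. (if s < y then g s else 0))" for y
  define F where "F x = (LINT y|dW. (if y \<le> x then G y else 0))" for x
  have bG: "bounded_borel G" unfolding G_def
    by (intro bounded_borel_add bounded_borel_const bounded_borel_integral_below ig)
  have bF: "bounded_borel F" unfolding F_def by (intro bounded_borel_integral_upto bG)
  have eq: "b * W x + iterated_integral W V g x = F x" if "x \<in> {0..1}" for x
    unfolding F_def G_def by (rule iterated_integral_eq[OF that ig])
  have fF: "AE x in torus_measure V. f x = F x"
    using f AE_space by eventually_elim (use eq in \<open>auto simp: space_torus\<close>)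
  have gF: "AE x in torus_measure V. g x = - \<mu> * F x"
    using fF gf by eventually_elim simp
  have "G y = b - \<mu> * (LINT s|torus_measure V. (if s < y then F s else 0))" for y
  proof -
    have "(LINT s|torus_measure V. (if s < y then g s else 0)) =
        (LINT s|torus_measure V. - \<mu> * (if s < y then F s else 0))"
    proof (rule integral_cong_AE)
      have [measurable]: "g \<in> borel_measurable (torus_measure V)" using ig by simp
      have [measurable]: "F \<in> borel_measurable (torus_measure V)"
        by (intro borel_measurable_N bounded_borelD bF)
      show "(\<lambda>s. if s < y then g s else 0) \<in> borel_measurable (torus_measure V)"
        "(\<lambda>s. - \<mu> * (if s < y then F s else 0)) \<in> borel_measurable (torus_measure V)"
        by measurable
      show "AE s in torus_measure V. (if s < y then g s else 0) = - \<mu> * (if s < y then F s else 0)"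
        using gF by eventually_elim simp
    qed
    then show ?thesis by (simp add: G_def)
  qed
  moreover have "F 1 = 0" using eq[of 1] one by simp
  ultimately have "eigenpair \<mu> G F" using bG bF by (auto simp: eigenpair_def F_def)
  with fF show thesis by (rule that[rotated])
qed

section \<open>Quadratic growth of the eigenvalues\<close>

lemma dirichlet_eigenvalue_ge:
  assumes strict: "strict_mono (\<lambda>x. W x + V x)" and ev: "dirichlet_eigenvalues W V ev" and n: "1 \<le> n"
  shows "1 / (W 1 + V 1)\<^sup>2 * (real n)\<^sup>2 \<le> ev n"
proof -
  define T where "T = W 1 + V 1"
  have T: "0 < T" unfolding T_def using strict_monoD[OF strict, of 0 1] W V by simp
  obtain f where f: "\<And>i. i \<in> {1..n} \<Longrightarrow> f i \<in> eigenspace W V (ev i)"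
    and ind: "\<And>\<nu> c. AE x in torus_measure V. (\<Sum>i | i \<in> {1..n} \<and> ev i = \<nu>. c i * f i x) = 0 \<Longrightarrow>
      \<forall>i\<in>{1..n}. ev i = \<nu> \<longrightarrow> c i = 0"
    using eigenfunction_family[OF ev] by blast
  have "\<exists>G F. eigenpair (ev i) G F \<and> (AE x in torus_measure V. f i x = F x)" if "i \<in> {1..n}" for i
    using eigenspace_imp_eigenpair[OF f[OF that]] by metis
  then obtain G F where e: "\<And>i. i \<in> {1..n} \<Longrightarrow> eigenpair (ev i) (G i) (F i)"
    and fF: "\<And>i. i \<in> {1..n} \<Longrightarrow> AE x in torus_measure V. f i x = F i x"
    by metis
  have all: "AE x in torus_measure V. \<forall>i\<in>{1..n}. f i x = F i x"
    using fF by (intro AE_finite_allI) auto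
  obtain a where a: "a 0 = 0" "a n = 1" "mono a" and a01: "\<And>j. a j \<in> {0..1}"
    and gap: "\<And>j x y. a j < x \<Longrightarrow> x \<le> y \<Longrightarrow> y < a (Suc j) \<Longrightarrow>
      (W y + V y) - (W x + V x) \<le> T / n"
    using quantile_partition[OF strict, of n] n W V by (auto simp: T_def)
  have m: "measure dW (space dW \<inter> {a j<..<a (Suc j)}) \<le> T / n"
    "measure (torus_measure V) (space (torus_measure V) \<inter> {a j<..<a (Suc j)}) \<le> T / n" for j
    using a01[of j] a01[of "Suc j"] T gap by (intro measure_gap_le; auto)+
  have "1 \<le> (T / n)\<^sup>2 * ev n"
  proof (rule eigenvalue_lower_bound[where S = "{1..n}" and \<mu> = ev and G = G and F = F and a = a])
    show "ev i \<le> ev n" if "i \<in> {1..n}" for i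
      using ev that by (auto simp: dirichlet_eigenvalues_def mono_on_def)
    show "\<forall>i\<in>{1..n}. ev i = \<nu> \<longrightarrow> c i = 0"
      if "AE x in torus_measure V. (\<Sum>i | i \<in> {1..n} \<and> ev i = \<nu>. c i * F i x) = 0" for \<nu> c
    proof (rule ind)
      show "AE x in torus_measure V. (\<Sum>i | i \<in> {1..n} \<and> ev i = \<nu>. c i * f i x) = 0"
        using that all by eventually_elim (auto intro!: sum.neutral elim!: trans[rotated] sum.cong)
    qed
  qed (use e a m T n in \<open>auto simp: space_dW\<close>)
  then have "(real n)\<^sup>2 \<le> T\<^sup>2 * ev n" using n by (simp add: power_divide pos_le_divide_eq)
  then have "(real n)\<^sup>2 / T\<^sup>2 \<le> ev n" using T by (simp add: pos_divide_le_eq mult.commute)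
  then show ?thesis by (simp add: T_def)
qed

end

lemma summable_inverse_powr_of_quadratic_growth:
  fixes e :: "nat \<Rightarrow> real"
  assumes C: "0 < C" and e: "\<And>n. 1 \<le> n \<Longrightarrow> C * (real n)\<^sup>2 \<le> e n" and s: "1 / 2 < s"
  shows "summable (\<lambda>i. 1 / e (Suc i) powr s)"
proof (rule summable_comparison_test')
  have "summable (\<lambda>n. real n powr (- (2 * s)))"
    using s by (subst summable_real_powr_iff) simp
  then have "summable (\<lambda>i. real (Suc i) powr (- (2 * s)))"
    by (subst summable_Suc_iff)
  then show "summable (\<lambda>i. C powr (- s) * real (Suc i) powr (- (2 * s)))"
    by (rule summable_mult)
  fix i :: nat
  have pos: "0 < C * (real (Suc i))\<^sup>2" using C by simp
  have "(C * (real (Suc i))\<^sup>2) powr s \<le> e (Suc i) powr s"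
    using pos s e[of "Suc i"] by (intro powr_mono2) auto
  then have "1 / e (Suc i) powr s \<le> 1 / (C * (real (Suc i))\<^sup>2) powr s"
    using pos by (intro divide_left_mono mult_pos_pos) (auto intro: less_le_trans)
  also have "\<dots> = C powr (- s) * real (Suc i) powr (- (2 * s))"
  proof -
    have sq: "(real (Suc i))\<^sup>2 = real (Suc i) powr 2" by (simp del: of_nat_Suc)
    have "((real (Suc i))\<^sup>2) powr s = real (Suc i) powr (2 * s)"
      by (simp only: sq powr_powr)
    then have "(C * (real (Suc i))\<^sup>2) powr s = C powr s * real (Suc i) powr (2 * s)"
      using C by (simp add: powr_mult del: of_nat_Suc)
    then show ?thesis by (simp add: powr_minus_divide del: of_nat_Suc)
  qed
  finally show "norm (1 / e (Suc i) powr s) \<le> C powr (- s) * real (Suc i) powr (- (2 * s))"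
    by simp
qed

theorem corollary20:
  fixes W V :: "real \<Rightarrow> real" and ev :: "nat \<Rightarrow> real"
  assumes "strict_mono W" and "strict_mono V"
    and "cadlag W" and "caglad V"
    and "\<And>x. W (x + 1) - W x = W 1 - W 0"
    and "\<And>x. V (x + 1) - V x = V 1 - V 0"
    and "isCont W 0" and "isCont V 0"
    and "W 0 = 0" and "V 0 = 0"
    and "dirichlet_eigenvalues W V ev"
  shows "\<exists>\<rho>::real. 0 < \<rho> \<and> \<rho> \<le> 1 / 2 \<and>
           (\<exists>C>0. \<forall>n\<ge>1. C * real n powr (1 / \<rho>) \<le> ev n) \<and>
           (\<forall>s>\<rho>. summable (\<lambda>i. 1 / ev (Suc i) powr s))"
proof -
  interpret string_functions W V
    using assms by unfold_locales (auto intro: strict_mono_mono)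
  have strict: "strict_mono (\<lambda>x. W x + V x)"
    using assms(1,2) by (auto simp: strict_mono_def intro: add_strict_mono)
  define C where "C = 1 / (W 1 + V 1)\<^sup>2"
  have C: "0 < C"
    using strict_monoD[OF strict, of 0 1] assms(9,10) by (simp add: C_def)
  have ge: "C * (real n)\<^sup>2 \<le> ev n" if "1 \<le> n" for n
    unfolding C_def by (rule dirichlet_eigenvalue_ge[OF strict assms(11) that])
  have "C * real n powr (1 / (1 / 2)) \<le> ev n" if "1 \<le> n" for n
    using ge[OF that] that by simp
  then show ?thesis
    using C summable_inverse_powr_of_quadratic_growth[OF C ge] by (intro exI[of _ "1 / 2"]) auto
qed

end
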